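(* Let $K_2$ be the complete graph on two vertices. Then $\pi(K_2) = 2$, whereas $\pi_s(K_2) = 3$.
   Context: All graphs are simple (no loops and no multiple edges). A configuration of $t$ pebbles on $G$ is a function $C : V(G) \to \{0,1,2,\dots\}$ with $\sum_{v} C(v) = t$; $C(v)$ is the number of pebbles on $v$. A pebbling move consists of choosing a vertex $u$ carrying at least two pebbles and a vertex $v$ adjacent to $u$, taking two pebbles off $u$, placing one of them on $v$ and removing the other from the game. Pebbling moves are applied in finite (possibly empty) sequences. The pebbling number $\pi(G)$ is the smallest $t$ such that, for every configuration of $t$ pebbles on $G$ and every vertex $r$ (the target vertex), there is a finite sequence of pebbling moves after which at least one pebble is on $r$. The singular pebbling number $\pi_s(G)$ is the smallest $t$ such that, for every configuration of at least $t$ pebbles on $G$ and every target vertex $r$, there is a finite sequence of pebbling moves after which exactly one pebble is on $r$. *)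

theory Defs
  imports "Graph_Theory.Kuratowski"
begin

text \<open>
  A configuration is a total function on the vertex type; only its values on
  the vertices of the graph matter, since pebbles are counted over the vertices
  and arcs join vertices to vertices. An undirected edge is a pair of opposite
  arcs, so a dominated vertex in a symmetric digraph is an adjacent one.
\<close>

definition num_pebbles :: "('a, 'b) pre_digraph \<Rightarrow> ('a \<Rightarrow> nat) \<Rightarrow> nat" where
  "num_pebbles G C = (\<Sum>v\<in>verts G. C v)"

text \<open>The simultaneous update relies on \<open>u \<noteq> v\<close>, i.e. on the absence of loops.\<close>

definition pebbling_move ::
  "('a, 'b) pre_digraph \<Rightarrow> ('a \<Rightarrow> nat) \<Rightarrow> ('a \<Rightarrow> nat) \<Rightarrow> bool" where
  "pebbling_move G C C' \<longleftrightarrow>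
     (\<exists>u v. u \<rightarrow>\<^bsub>G\<^esub> v \<and> 2 \<le> C u \<and> C' = C(u := C u - 2, v := C v + 1))"

text \<open>
  Both numbers below are unspecified if no suitable \<open>t\<close> exists
  (for instance the first one if the graph is disconnected).
\<close>

definition pebbling_number :: "('a, 'b) pre_digraph \<Rightarrow> nat" where
  "pebbling_number G =
     (LEAST t. \<forall>C. num_pebbles G C = t \<longrightarrow>
        (\<forall>r\<in>verts G. \<exists>C'. (pebbling_move G)\<^sup>*\<^sup>* C C' \<and> 1 \<le> C' r))"

definition singular_pebbling_number :: "('a, 'b) pre_digraph \<Rightarrow> nat" where
  "singular_pebbling_number G =
     (LEAST t. \<forall>C. t \<le> num_pebbles G C \<longrightarrow>
        (\<forall>r\<in>verts G. \<exists>C'. (pebbling_move G)\<^sup>*\<^sup>* C C' \<and> C' r = 1))"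

end

theory Submission
  imports Defs
begin

lemma complete_digraph_2E:
  assumes "K\<^bsub>2\<^esub> G"
  obtains a b where "a \<noteq> b" "verts G = {a, b}" "arcs_ends G = {(a, b), (b, a)}"
proof -
  have "card (verts G) = 2"
    and arcs: "arcs_ends G = {(u, v). (u, v) \<in> verts G \<times> verts G \<and> u \<noteq> v}"
    using assms by (auto simp: complete_digraph_def)
  then obtain a b where "verts G = {a, b}" "a \<noteq> b"
    by (auto simp: card_2_iff)
  moreover from this arcs have "arcs_ends G = {(a, b), (b, a)}"
    by auto
  ultimately show ?thesis
    using that by blast
qed

lemma pebbling_moveI:
  assumes "u \<rightarrow>\<^bsub>G\<^esub> v" "2 \<le> C u"
  shows "pebbling_move G C (C(u := C u - 2, v := C v + 1))"
  using assms by (auto simp: pebbling_move_def)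

text \<open>If no tail of an arc carries two pebbles, no first move exists, so only the empty
  sequence is available. Both lower bounds use this to rule out further moves.\<close>

lemma rtranclp_pebbling_move_stuck:
  assumes "(pebbling_move G)\<^sup>*\<^sup>* C C'" "\<And>u v. u \<rightarrow>\<^bsub>G\<^esub> v \<Longrightarrow> C u \<le> 1"
  shows "C' = C"
  using assms(1)
proof (cases rule: converse_rtranclpE)
  case (step D)
  then show ?thesis
    using assms(2) by (fastforce simp: pebbling_move_def)
qed simp

text \<open>
  Moves from \<open>r\<close> to \<open>s\<close> preserve the parity of \<open>C r\<close> and the weight \<open>C r + 2 * C s\<close>.
  If \<open>C r\<close> is even, they empty \<open>r\<close>, and weight 4 then leaves two pebbles on \<open>s\<close>
  for the move back.
\<close>

lemma exactly_one_pebble_reachable: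
  assumes "r \<noteq> s" "r \<rightarrow>\<^bsub>G\<^esub> s" "s \<rightarrow>\<^bsub>G\<^esub> r" "odd (C r) \<or> 4 \<le> C r + 2 * C s"
  shows "\<exists>C'. (pebbling_move G)\<^sup>*\<^sup>* C C' \<and> C' r = 1"
  using assms(4)
proof (induction "C r" arbitrary: C rule: less_induct)
  case less
  consider "C r = 0" | "C r = 1" | "2 \<le> C r" by linarith
  then show ?case
  proof cases
    case 1
    \<comment> \<open>Zero is even, so it is the weight bound that holds here; the move back then
      puts exactly one pebble on the empty \<open>r\<close>.\<close>
    then have "2 \<le> C s" using less.prems by simp
    from r_into_rtranclp[where r = "pebbling_move G", OF pebbling_moveI[where C = C, OF assms(3) this]]
    show ?thesis
      using 1 by (intro exI conjI) (assumption, simp)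
  next
    case 2
    then show ?thesis by blast
  next
    case 3
    let ?D = "C(r := C r - 2, s := C s + 1)"
    have "?D r < C r" "odd (?D r) \<or> 4 \<le> ?D r + 2 * ?D s"
      using 3 less.prems \<open>r \<noteq> s\<close> by auto
    from less.hyps[OF this] pebbling_moveI[where C = C, OF assms(2) 3] show ?thesis
      by (meson converse_rtranclp_into_rtranclp)
  qed
qed

lemma pebbling_number_complete_2:
  assumes "K\<^bsub>2\<^esub> G"
  shows "pebbling_number G = 2"
proof -
  obtain a b where G: "a \<noteq> b" "verts G = {a, b}" "arcs_ends G = {(a, b), (b, a)}"
    using assms by (rule complete_digraph_2E)
  show ?thesis
    unfolding pebbling_number_def
  proof (rule Least_equality)
    \<comment> \<open>The target \<open>r\<close> and the other vertex \<open>s\<close> are kept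
      generic, so that swapping \<open>a\<close> and \<open>b\<close> covers both targets. Either
      \<open>r\<close> is already occupied, or both pebbles lie on \<open>s\<close> and one move
      suffices.\<close>
    have "\<exists>C'. (pebbling_move G)\<^sup>*\<^sup>* C C' \<and> 1 \<le> C' r"
      if C: "C r + C s = 2" and rs: "r \<noteq> s" "s \<rightarrow>\<^bsub>G\<^esub> r" for C r s
    proof (cases "C r = 0")
      case True
      then have "2 \<le> C s" using C by simp
      from r_into_rtranclp[where r = "pebbling_move G", OF pebbling_moveI[where C = C, OF rs(2) this]]
      show ?thesis
        by (intro exI conjI) (assumption, simp)
    next
      case False
      then show ?thesis by (intro exI[of _ C]) simp
    qed
    from this[of _ a b] this[of _ b a]
    show "\<forall>C. num_pebbles G C = 2 \<longrightarrow>
        (\<forall>r\<in>verts G. \<exists>C'. (pebbling_move G)\<^sup>*\<^sup>* C C' \<and> 1 \<le> C' r)"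
      using G by (auto simp: num_pebbles_def add.commute)
  next
    fix t
    assume t: "\<forall>C. num_pebbles G C = t \<longrightarrow>
        (\<forall>r\<in>verts G. \<exists>C'. (pebbling_move G)\<^sup>*\<^sup>* C C' \<and> 1 \<le> C' r)"
    show "2 \<le> t"
    proof (rule ccontr)
      assume "\<not> 2 \<le> t"
      \<comment> \<open>With t \<le> 1, all pebbles on \<open>a\<close> and target \<open>b\<close>,
        no move is possible and \<open>b\<close> stays empty.\<close>
      let ?C = "(\<lambda>_. 0)(a := t)"
      have "num_pebbles G ?C = t"
        using G by (simp add: num_pebbles_def)
      with t G obtain C' where C': "(pebbling_move G)\<^sup>*\<^sup>* ?C C'" "1 \<le> C' b"
        by blast
      have "C' = ?C"
        using C'(1) by (rule rtranclp_pebbling_move_stuck) (use \<open>\<not> 2 \<le> t\<close> in auto)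
      with C'(2) G show False by simp
    qed
  qed
qed

lemma singular_pebbling_number_complete_2:
  assumes "K\<^bsub>2\<^esub> G"
  shows "singular_pebbling_number G = 3"
proof -
  obtain a b where G: "a \<noteq> b" "verts G = {a, b}" "arcs_ends G = {(a, b), (b, a)}"
    using assms by (rule complete_digraph_2E)
  show ?thesis
    unfolding singular_pebbling_number_def
  proof (rule Least_equality)
    have "\<exists>C'. (pebbling_move G)\<^sup>*\<^sup>* C C' \<and> C' r = 1"
      if "3 \<le> C r + C s" "r \<noteq> s" "r \<rightarrow>\<^bsub>G\<^esub> s" "s \<rightarrow>\<^bsub>G\<^esub> r" for C r s
    proof (rule exactly_one_pebble_reachable[OF that(2-4)])
      \<comment> \<open>Let \<open>C r\<close> be even. If \<open>C s\<close> is positive, it adds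
        at least 1 to the total of at least 3. If \<open>C s = 0\<close>, then \<open>C r\<close> is
        even and at least 3, hence at least 4.\<close>
      show "odd (C r) \<or> 4 \<le> C r + 2 * C s"
        using that(1) by presburger
    qed
    from this[of _ a b] this[of _ b a]
    show "\<forall>C. 3 \<le> num_pebbles G C \<longrightarrow>
        (\<forall>r\<in>verts G. \<exists>C'. (pebbling_move G)\<^sup>*\<^sup>* C C' \<and> C' r = 1)"
      using G by (auto simp: num_pebbles_def add.commute)
  next
    fix t
    assume t: "\<forall>C. t \<le> num_pebbles G C \<longrightarrow>
        (\<forall>r\<in>verts G. \<exists>C'. (pebbling_move G)\<^sup>*\<^sup>* C C' \<and> C' r = 1)"
    show "3 \<le> t"
    proof (rule ccontr)
      assume "\<not> 3 \<le> t"
      \<comment> \<open>The target is \<open>a\<close> itself, which holds one pebble too many.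
        Since t bounds the number of pebbles only from below, this single configuration refutes
        every t \<le> 2.\<close>
      let ?C = "(\<lambda>_. 0)(a := 2)" and ?D = "(\<lambda>_. 0)(b := 1)"
      have "t \<le> num_pebbles G ?C"
        using G \<open>\<not> 3 \<le> t\<close> by (simp add: num_pebbles_def)
      with t G obtain C' where C': "(pebbling_move G)\<^sup>*\<^sup>* ?C C'" "C' a = 1"
        by blast
      from C'(1) have "C' = ?C \<or> C' = ?D"
      proof (cases rule: converse_rtranclpE)
        case (step E)
        \<comment> \<open>Only \<open>a\<close> has two pebbles, so the first move must go from
          \<open>a\<close> to \<open>b\<close>. It leaves a lone pebble on \<open>b\<close>, and
          play stops: \<open>a\<close> holds 2 or 0 pebbles, never 1.\<close>
        from step(1) have "E = ?D"
          using G by (auto simp: pebbling_move_def split: if_splits)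
        with step(2) have "(pebbling_move G)\<^sup>*\<^sup>* ?D C'" by simp
        then have "C' = ?D"
          by (rule rtranclp_pebbling_move_stuck) simp
        then show ?thesis ..
      qed simp
      with C'(2) G show False by auto
    qed
  qed
qed

theorem mainTheorem3:
  fixes G :: "('a, 'b) pre_digraph"
  assumes "K\<^bsub>2\<^esub> G"
  shows "pebbling_number G = 2 \<and> singular_pebbling_number G = 3"
  using assms by (simp add: pebbling_number_complete_2 singular_pebbling_number_complete_2)

end
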